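(* Let $r\in A$ be a value of $|\cdot|_p$ on $\mathbb{Q}_p$, and let $\mu$ be the normalized Haar measure on $S_r(0)$. 1. If $p\geq 3$, then the dynamical system $(S_r(0),f,\mu)$ is not ergodic for any such $r\in A$. 2. Let $p=2$. (2.1) If $\alpha=\beta$, then $(S_r(0),f,\mu)$ is not ergodic for any such $r\in A$. (2.2) If $\alpha<\beta$, then $(S_r(0),f,\mu)$ is not ergodic for any such $r\in A\setminus\{\frac{\beta}{2}\}$.
   Context: $p$ is a prime, $a,b\in\mathbb{Q}_p$ with $ab\neq0$, and $\sqrt{a^2-4b}$ is assumed to exist in $\mathbb{Q}_p$. $f(x)=\frac{x^3+ax^2+bx}{ax+b}$ is considered on $\mathbb{Q}_p\setminus\{-\frac{b}{a}\}$. Let $x_1,x_2=\frac{-a\pm\sqrt{a^2-4b}}{2}\in\mathbb{Q}_p$, labelled so that $\alpha:=|x_1|_p\leq\beta:=|x_2|_p$, and $\delta=|a|_p$. (One has $\delta\leq\alpha$ if $\alpha=\beta$, and $\delta=\beta$ if $\alpha<\beta$.) Define $A=\{r:0<r<\alpha\}$ if $\delta\leq\alpha=\beta$, and $A=(0,\beta)\setminus\{\alpha\}$ if $\alpha<\beta=\delta$. $S_r(0)=\{x\in\mathbb{Q}_p:|x|_p=r\}$ and $V_\rho(c)=\{x\in\mathbb{Q}_p:|x-c|_p\leq\rho\}$. For $r\in A$ the sphere $S_r(0)$ is invariant under $f$. The normalized Haar measure $\mu$ on (Borel subsets of) $S_r(0)$ is the probability measure with $\mu(V_\rho(c))=\frac{\rho}{r(1-1/p)}$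 for balls $V_\rho(c)\subset S_r(0)$ with $\rho\in\{p^n:n\in\mathbb{Z}\}$; $f$ preserves $\mu$. The system is ergodic if every measurable invariant set $V$ (i.e. $f^{-1}(V)=V$) has $\mu(V)=0$ or $\mu(V)=1$. *)

theory Defs
  imports
    "HOL-Probability.Probability"
    "Berlekamp_Zassenhaus.Finite_Field"
begin

section \<open>The \<open>p\<close>-adic absolute value on the rationals\<close>

definition padic_abs :: "nat \<Rightarrow> rat \<Rightarrow> real" where
  "padic_abs p q =
     (if q = 0 then 0
      else real p powi (int (multiplicity (int p) (snd (quotient_of q)))
                      - int (multiplicity (int p) (fst (quotient_of q)))))"

context
  fixes p :: nat
  assumes p: "prime p"
begin

lemma padic_abs_divide:
  assumes "a \<noteq> 0" "b \<noteq> 0"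
  shows "padic_abs p (of_int a / of_int b) =
    real p powi (int (multiplicity (int p) b) - int (multiplicity (int p) a))"
proof -
  obtain c d where cd: "quotient_of (of_int a / of_int b) = (c, d)"
    by fastforce
  have d: "d > 0" using quotient_of_denom_pos[OF cd] .
  have eq: "(of_int a / of_int b :: rat) = of_int c / of_int d"
    using quotient_of_div[OF cd] .
  have "(of_int (a * d) :: rat) = of_int (c * b)"
    using eq assms d by (simp add: field_simps)
  hence e: "a * d = c * b" by (simp only: of_int_eq_iff)
  have c: "c \<noteq> 0" using e assms d by auto
  have pe: "prime_elem (int p)" using p by auto
  have "multiplicity (int p) a + multiplicity (int p) d
      = multiplicity (int p) c + multiplicity (int p) b"
    using arg_cong[OF e, of "multiplicity (int p)"] assms c d
    by (simp add: prime_elem_multiplicity_mult_distrib[OF pe])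
  hence "int (multiplicity (int p) d) - int (multiplicity (int p) c)
       = int (multiplicity (int p) b) - int (multiplicity (int p) a)"
    by linarith
  thus ?thesis using assms by (simp add: padic_abs_def cd)
qed

lemma padic_abs_0 [simp]: "padic_abs p 0 = 0"
  by (simp add: padic_abs_def)

lemma padic_abs_1 [simp]: "padic_abs p 1 = 1"
  using padic_abs_divide[of 1 1] by simp

lemma padic_abs_eq_0_iff [simp]: "padic_abs p x = 0 \<longleftrightarrow> x = 0"
  using p by (auto simp: padic_abs_def)

lemma padic_abs_nonneg [simp]: "0 \<le> padic_abs p x"
  by (simp add: padic_abs_def)

lemma rat_as_fraction:
  fixes x :: rat
  obtains a b :: int where "b \<noteq> 0" "x = of_int a / of_int b"
proof -
  obtain a b where ab: "quotient_of x = (a, b)" by fastforce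
  show ?thesis
    using that[of b a] quotient_of_denom_pos[OF ab] quotient_of_div[OF ab] by simp
qed

lemma padic_abs_mult: "padic_abs p (x * y) = padic_abs p x * padic_abs p y"
proof (cases "x = 0 \<or> y = 0")
  case False
  obtain a b where ab: "b \<noteq> 0" "x = of_int a / of_int b" by (rule rat_as_fraction)
  obtain c d where cd: "d \<noteq> 0" "y = of_int c / of_int d" by (rule rat_as_fraction)
  have nz: "a \<noteq> 0" "c \<noteq> 0" using False ab cd by auto
  have pe: "prime_elem (int p)" using p by auto
  have xy: "x * y = of_int (a * c) / of_int (b * d)" by (simp add: ab cd)
  have "padic_abs p (x * y) = real p powi
     ((int (multiplicity (int p) b) - int (multiplicity (int p) a))
    + (int (multiplicity (int p) d) - int (multiplicity (int p) c)))"
    unfolding xy using nz ab cd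
    by (subst padic_abs_divide)
       (auto simp: prime_elem_multiplicity_mult_distrib[OF pe] algebra_simps)
  also have "\<dots> = padic_abs p x * padic_abs p y"
    using nz ab cd p by (simp add: padic_abs_divide power_int_add)
  finally show ?thesis .
qed auto

lemma padic_abs_minus [simp]: "padic_abs p (- x) = padic_abs p x"
proof -
  have "padic_abs p (- 1) * padic_abs p (- 1) = 1"
    by (subst padic_abs_mult[symmetric]) simp
  hence "padic_abs p (- 1) = 1"
    using padic_abs_nonneg[of "-1"] by (simp add: square_eq_1_iff)
  thus ?thesis using padic_abs_mult[of "-1" x] by simp
qed

lemma padic_abs_inverse: "padic_abs p (inverse x) = inverse (padic_abs p x)"
proof (cases "x = 0")
  case False
  hence "padic_abs p x * padic_abs p (inverse x) = 1"
    by (subst padic_abs_mult[symmetric]) simp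
  thus ?thesis by (simp add: inverse_unique)
qed simp

lemma padic_abs_one_plus:
  assumes "padic_abs p z \<le> 1"
  shows "padic_abs p (1 + z) \<le> 1"
proof (cases "z = 0 \<or> 1 + z = 0")
  case True
  thus ?thesis by auto
next
  case False
  obtain a b where ab: "b \<noteq> 0" "z = of_int a / of_int b" by (rule rat_as_fraction)
  have a: "a \<noteq> 0" using False ab by auto
  have p1: "real p > 1" using p prime_gt_1_nat by auto
  have z1: "1 + z = of_int (a + b) / of_int b" using ab by (simp add: field_simps)
  have s: "a + b \<noteq> 0" using z1 False by (metis div_0 of_int_0)
  have "real p powi (int (multiplicity (int p) b) - int (multiplicity (int p) a)) \<le> real p powi 0"
    using assms a ab by (simp add: padic_abs_divide)
  hence le: "multiplicity (int p) b \<le> multiplicity (int p) a"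
    using power_int_le_imp_le_exp[OF p1] by fastforce
  have "int p ^ multiplicity (int p) b dvd a + b"
    using le by (intro dvd_add multiplicity_dvd' multiplicity_dvd) auto
  hence "multiplicity (int p) b \<le> multiplicity (int p) (a + b)"
    using s p by (intro multiplicity_geI) auto
  hence "real p powi (int (multiplicity (int p) b) - int (multiplicity (int p) (a + b)))
      \<le> real p powi 0"
    using p1 by (intro power_int_increasing) auto
  thus ?thesis unfolding z1 using s ab by (subst padic_abs_divide) auto
qed

lemma padic_abs_ultra: "padic_abs p (x + y) \<le> max (padic_abs p x) (padic_abs p y)"
proof -
  have *: "padic_abs p (u + v) \<le> padic_abs p v"
    if le: "padic_abs p u \<le> padic_abs p v" and v: "v \<noteq> 0" for u v
  proof -
    have pos: "padic_abs p v > 0"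
      using v padic_abs_nonneg[of v] padic_abs_eq_0_iff[of v] by linarith
    have "padic_abs p (u / v) = padic_abs p u / padic_abs p v"
      by (simp add: divide_inverse padic_abs_mult padic_abs_inverse)
    hence "padic_abs p (u / v) \<le> 1"
      using le pos by (simp add: divide_le_eq)
    hence "padic_abs p (1 + u / v) \<le> 1" by (rule padic_abs_one_plus)
    moreover have "u + v = v * (1 + u / v)" using v by (simp add: field_simps)
    ultimately show ?thesis
      using pos by (simp add: padic_abs_mult mult_le_cancel_left2)
  qed
  show ?thesis
  proof (cases "x = 0 \<or> y = 0")
    case False
    thus ?thesis using *[of x y] *[of y x] by (auto simp: add.commute max_def)
  qed auto
qed

lemma padic_abs_triangle: "padic_abs p (x + y) \<le> padic_abs p x + padic_abs p y"
  using padic_abs_ultra[of x y] padic_abs_nonneg[of x] padic_abs_nonneg[of y] by linarith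

lemma padic_abs_minus_commute: "padic_abs p (x - y) = padic_abs p (y - x)"
  using padic_abs_minus[of "x - y"] by simp

lemma padic_abs_reverse_triangle:
  "\<bar>padic_abs p x - padic_abs p y\<bar> \<le> padic_abs p (x - y)"
  using padic_abs_triangle[of "x - y" y] padic_abs_triangle[of "y - x" x]
    padic_abs_minus_commute[of x y] by simp

end


section \<open>The field of \<open>p\<close>-adic numbers\<close>

text \<open>
  \<open>'p padic\<close> is the completion of the rationals with respect to \<^const>\<open>padic_abs\<close> for the prime
  \<open>p = CARD('p)\<close>: Cauchy sequences of rationals modulo null sequences.
\<close>

definition padic_vanishes :: "nat \<Rightarrow> (nat \<Rightarrow> rat) \<Rightarrow> bool" where
  "padic_vanishes p X \<longleftrightarrow> (\<lambda>n. padic_abs p (X n)) \<longlonglongrightarrow> 0"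

definition padic_cauchy :: "nat \<Rightarrow> (nat \<Rightarrow> rat) \<Rightarrow> bool" where
  "padic_cauchy p X \<longleftrightarrow>
     (\<forall>e>0. \<exists>N. \<forall>m\<ge>N. \<forall>n\<ge>N. padic_abs p (X m - X n) < e)"

context
  fixes p :: nat
  assumes p: "prime p"
begin

lemma padic_vanishes_0: "padic_vanishes p (\<lambda>_. 0)"
  by (simp add: padic_vanishes_def padic_abs_0[OF p])

lemma padic_vanishes_const_iff: "padic_vanishes p (\<lambda>_. c) \<longleftrightarrow> c = 0"
  by (simp add: padic_vanishes_def LIMSEQ_const_iff padic_abs_eq_0_iff[OF p])

lemma padic_vanishes_minus: "padic_vanishes p X \<Longrightarrow> padic_vanishes p (\<lambda>n. - X n)"
  by (simp add: padic_vanishes_def padic_abs_minus[OF p])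

lemma padic_vanishes_le:
  assumes "Y \<longlonglongrightarrow> 0" "\<And>n. padic_abs p (X n) \<le> Y n"
  shows "padic_vanishes p X"
  unfolding padic_vanishes_def
  by (rule tendsto_sandwich[OF _ _ tendsto_const assms(1)])
     (auto simp: assms(2) padic_abs_nonneg[OF p])

lemma padic_vanishes_add:
  assumes "padic_vanishes p X" "padic_vanishes p Y"
  shows "padic_vanishes p (\<lambda>n. X n + Y n)"
  using tendsto_add[OF assms[unfolded padic_vanishes_def]] padic_abs_triangle[OF p]
  by (intro padic_vanishes_le[of "\<lambda>n. padic_abs p (X n) + padic_abs p (Y n)"]) auto

lemma padic_cauchy_const: "padic_cauchy p (\<lambda>_. c)"
  by (auto simp: padic_cauchy_def padic_abs_0[OF p])

lemma padic_cauchy_minus: "padic_cauchy p X \<Longrightarrow> padic_cauchy p (\<lambda>n. - X n)"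
  by (simp add: padic_cauchy_def padic_abs_minus_commute[OF p])

lemma padic_cauchy_add:
  assumes "padic_cauchy p X" "padic_cauchy p Y"
  shows "padic_cauchy p (\<lambda>n. X n + Y n)"
  unfolding padic_cauchy_def
proof (intro allI impI)
  fix e :: real assume e: "e > 0"
  obtain M where M: "\<forall>m\<ge>M. \<forall>n\<ge>M. padic_abs p (X m - X n) < e"
    using assms(1) e unfolding padic_cauchy_def by blast
  obtain N where N: "\<forall>m\<ge>N. \<forall>n\<ge>N. padic_abs p (Y m - Y n) < e"
    using assms(2) e unfolding padic_cauchy_def by blast
  have "padic_abs p (X m + Y m - (X n + Y n)) < e" if "m \<ge> max M N" "n \<ge> max M N" for m n
  proof -
    have "padic_abs p ((X m - X n) + (Y m - Y n))
        \<le> max (padic_abs p (X m - X n)) (padic_abs p (Y m - Y n))"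
      by (rule padic_abs_ultra[OF p])
    also have "\<dots> < e" using M N that by auto
    finally show ?thesis by (simp add: algebra_simps)
  qed
  thus "\<exists>K. \<forall>m\<ge>K. \<forall>n\<ge>K. padic_abs p (X m + Y m - (X n + Y n)) < e" by blast
qed

lemma padic_cauchy_convergent:
  assumes "padic_cauchy p X"
  shows "convergent (\<lambda>n. padic_abs p (X n))"
proof -
  have "Cauchy (\<lambda>n. padic_abs p (X n))"
    unfolding Cauchy_def dist_real_def
    using assms padic_abs_reverse_triangle[OF p] unfolding padic_cauchy_def
    by (meson le_less_trans)
  thus ?thesis by (rule Cauchy_convergent)
qed

lemma padic_cauchy_bounded:
  assumes "padic_cauchy p X"
  obtains B where "B > 0" "\<And>n. padic_abs p (X n) \<le> B"
proof -
  have "Bseq (\<lambda>n. padic_abs p (X n))"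
    using padic_cauchy_convergent[OF assms] by (rule convergent_imp_Bseq)
  thus ?thesis using that by (auto simp: Bseq_def padic_abs_nonneg[OF p])
qed

lemma padic_cauchy_mult:
  assumes "padic_cauchy p X" "padic_cauchy p Y"
  shows "padic_cauchy p (\<lambda>n. X n * Y n)"
  unfolding padic_cauchy_def
proof (intro allI impI)
  fix e :: real assume e: "e > 0"
  obtain A where A: "A > 0" "\<And>n. padic_abs p (X n) \<le> A"
    using padic_cauchy_bounded[OF assms(1)] by blast
  obtain B where B: "B > 0" "\<And>n. padic_abs p (Y n) \<le> B"
    using padic_cauchy_bounded[OF assms(2)] by blast
  obtain M where M: "\<forall>m\<ge>M. \<forall>n\<ge>M. padic_abs p (X m - X n) < e / B"
    using assms(1) e B unfolding padic_cauchy_def by (meson divide_pos_pos)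
  obtain N where N: "\<forall>m\<ge>N. \<forall>n\<ge>N. padic_abs p (Y m - Y n) < e / A"
    using assms(2) e A unfolding padic_cauchy_def by (meson divide_pos_pos)
  have "padic_abs p (X m * Y m - X n * Y n) < e" if mn: "m \<ge> max M N" "n \<ge> max M N" for m n
  proof -
    have "X m * Y m - X n * Y n = X m * (Y m - Y n) + (X m - X n) * Y n"
      by (simp add: algebra_simps)
    hence "padic_abs p (X m * Y m - X n * Y n)
        \<le> max (padic_abs p (X m) * padic_abs p (Y m - Y n))
              (padic_abs p (X m - X n) * padic_abs p (Y n))"
      using padic_abs_ultra[OF p, of "X m * (Y m - Y n)" "(X m - X n) * Y n"]
      by (simp add: padic_abs_mult[OF p])
    moreover have "padic_abs p (X m) * padic_abs p (Y m - Y n) < e"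
    proof -
      have "padic_abs p (X m) * padic_abs p (Y m - Y n) \<le> A * padic_abs p (Y m - Y n)"
        using A by (intro mult_right_mono padic_abs_nonneg[OF p]) auto
      also have "\<dots> < A * (e / A)" using N mn A by (intro mult_strict_left_mono) auto
      finally show ?thesis using A by simp
    qed
    moreover have "padic_abs p (X m - X n) * padic_abs p (Y n) < e"
    proof -
      have "padic_abs p (X m - X n) * padic_abs p (Y n) \<le> padic_abs p (X m - X n) * B"
        using B by (intro mult_left_mono padic_abs_nonneg[OF p]) auto
      also have "\<dots> < (e / B) * B" using M mn B by (intro mult_strict_right_mono) auto
      finally show ?thesis using B by simp
    qed
    ultimately show ?thesis by linarith
  qed
  thus "\<exists>K. \<forall>m\<ge>K. \<forall>n\<ge>K. padic_abs p (X m * Y m - X n * Y n) < e" by blast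
qed

lemma padic_vanishes_mult:
  assumes "padic_cauchy p X" "padic_vanishes p Y"
  shows "padic_vanishes p (\<lambda>n. X n * Y n)"
proof -
  obtain A where A: "A > 0" "\<And>n. padic_abs p (X n) \<le> A"
    using padic_cauchy_bounded[OF assms(1)] by blast
  have "(\<lambda>n. A * padic_abs p (Y n)) \<longlonglongrightarrow> 0"
    using tendsto_mult_left[OF assms(2)[unfolded padic_vanishes_def], of A] by simp
  thus ?thesis
    by (rule padic_vanishes_le)
       (simp add: padic_abs_mult[OF p] mult_right_mono[OF A(2) padic_abs_nonneg[OF p]])
qed

lemma padic_cauchy_not_vanishes:
  assumes X: "padic_cauchy p X" and nv: "\<not> padic_vanishes p X"
  obtains c N where "c > 0" "\<And>n. n \<ge> N \<Longrightarrow> padic_abs p (X n) \<ge> c"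
proof -
  obtain l where l: "(\<lambda>n. padic_abs p (X n)) \<longlonglongrightarrow> l"
    using padic_cauchy_convergent[OF X] by (auto simp: convergent_def)
  have "l \<ge> 0" using l by (rule LIMSEQ_le_const) (auto simp: padic_abs_nonneg[OF p])
  moreover have "l \<noteq> 0" using nv l by (auto simp: padic_vanishes_def)
  ultimately have lp: "l > 0" by simp
  have "\<forall>\<^sub>F n in sequentially. padic_abs p (X n) > l / 2"
    using l lp by (intro order_tendstoD) auto
  then obtain N where "\<And>n. n \<ge> N \<Longrightarrow> padic_abs p (X n) > l / 2"
    by (auto simp: eventually_sequentially)
  thus ?thesis using lp by (intro that[of "l / 2" N]) (auto intro: less_imp_le)
qed

lemma padic_abs_inverse_diff:
  assumes "c > 0" "padic_abs p x \<ge> c" "padic_abs p y \<ge> c"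
  shows "padic_abs p (inverse x - inverse y) \<le> padic_abs p (x - y) / (c * c)"
proof -
  have nz: "x \<noteq> 0" "y \<noteq> 0" using assms padic_abs_0[OF p] by auto
  have "inverse x - inverse y = (y - x) * inverse (x * y)" using nz by (simp add: field_simps)
  hence "padic_abs p (inverse x - inverse y)
      = padic_abs p (x - y) / (padic_abs p x * padic_abs p y)"
    by (simp add: padic_abs_mult[OF p] padic_abs_inverse[OF p] padic_abs_minus_commute[OF p, of y]
        divide_inverse)
  also have "\<dots> \<le> padic_abs p (x - y) / (c * c)"
    using assms by (intro divide_left_mono mult_mono padic_abs_nonneg[OF p] mult_pos_pos) auto
  finally show ?thesis .
qed

lemma padic_cauchy_inverse:
  assumes X: "padic_cauchy p X" and nv: "\<not> padic_vanishes p X"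
  shows "padic_cauchy p (\<lambda>n. inverse (X n))"
  unfolding padic_cauchy_def
proof (intro allI impI)
  fix e :: real assume e: "e > 0"
  obtain c N where c: "c > 0" and N: "\<And>n. n \<ge> N \<Longrightarrow> padic_abs p (X n) \<ge> c"
    using padic_cauchy_not_vanishes[OF assms] by blast
  have "e * (c * c) > 0" using e c by simp
  then obtain M where M: "\<forall>m\<ge>M. \<forall>n\<ge>M. padic_abs p (X m - X n) < e * (c * c)"
    using X unfolding padic_cauchy_def by blast
  have "padic_abs p (inverse (X m) - inverse (X n)) < e" if "m \<ge> max M N" "n \<ge> max M N" for m n
  proof -
    have "padic_abs p (inverse (X m) - inverse (X n)) \<le> padic_abs p (X m - X n) / (c * c)"
      using that by (intro padic_abs_inverse_diff c N) auto
    also have "\<dots> < e" using M that c by (simp add: divide_less_eq)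
    finally show ?thesis .
  qed
  thus "\<exists>K. \<forall>m\<ge>K. \<forall>n\<ge>K. padic_abs p (inverse (X m) - inverse (X n)) < e" by blast
qed

lemma padic_vanishes_inverse_diff:
  assumes X: "padic_cauchy p X" "\<not> padic_vanishes p X"
    and Y: "padic_cauchy p Y" "\<not> padic_vanishes p Y"
    and XY: "padic_vanishes p (\<lambda>n. X n - Y n)"
  shows "padic_vanishes p (\<lambda>n. inverse (X n) - inverse (Y n))"
proof -
  obtain c N where c: "c > 0" "\<And>n. n \<ge> N \<Longrightarrow> padic_abs p (X n) \<ge> c"
    using padic_cauchy_not_vanishes[OF X] by blast
  obtain d M where d: "d > 0" "\<And>n. n \<ge> M \<Longrightarrow> padic_abs p (Y n) \<ge> d"
    using padic_cauchy_not_vanishes[OF Y] by blast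
  define m where "m = min c d"
  have m: "m > 0" using c d by (simp add: m_def)
  have ev: "\<forall>\<^sub>F n in sequentially. padic_abs p (inverse (X n) - inverse (Y n))
      \<le> padic_abs p (X n - Y n) / (m * m)"
    using eventually_ge_at_top[of "max N M"]
  proof eventually_elim
    case (elim n)
    thus ?case using c(2)[of n] d(2)[of n] by (intro padic_abs_inverse_diff m) (auto simp: m_def)
  qed
  have lim: "(\<lambda>n. padic_abs p (X n - Y n) / (m * m)) \<longlonglongrightarrow> 0"
    using tendsto_divide[OF XY[unfolded padic_vanishes_def] tendsto_const, of "m * m"] m by simp
  show ?thesis unfolding padic_vanishes_def
    by (rule tendsto_sandwich[OF _ ev tendsto_const lim]) (auto simp: padic_abs_nonneg[OF p])
qed

lemma padic_vanishes_cong: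
  assumes "padic_vanishes p (\<lambda>n. X n - Y n)"
  shows "padic_vanishes p X \<longleftrightarrow> padic_vanishes p Y"
  using padic_vanishes_add[OF assms, of Y]
    padic_vanishes_add[OF padic_vanishes_minus[OF assms], of X] by auto

end

definition padic_rel :: "'p::prime_card itself \<Rightarrow> (nat \<Rightarrow> rat) \<Rightarrow> (nat \<Rightarrow> rat) \<Rightarrow> bool" where
  "padic_rel _ X Y \<longleftrightarrow> padic_cauchy CARD('p) X \<and> padic_cauchy CARD('p) Y
     \<and> padic_vanishes CARD('p) (\<lambda>n. X n - Y n)"

lemma padic_rel_refl: "padic_cauchy CARD('p) X \<Longrightarrow> padic_rel TYPE('p::prime_card) X X"
  by (simp add: padic_rel_def padic_vanishes_0[OF prime_card])

lemma part_equivp_padic_rel: "part_equivp (padic_rel TYPE('p::prime_card))"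
proof (rule part_equivpI)
  show "\<exists>X. padic_rel TYPE('p) X X"
    using padic_rel_refl padic_cauchy_const[OF prime_card] by blast
  show "symp (padic_rel TYPE('p))"
    by (rule sympI) (auto simp: padic_rel_def dest: padic_vanishes_minus[OF prime_card])
  show "transp (padic_rel TYPE('p))"
  proof (rule transpI)
    fix X Y Z assume a: "padic_rel TYPE('p) X Y" "padic_rel TYPE('p) Y Z"
    have "padic_vanishes CARD('p) (\<lambda>n. (X n - Y n) + (Y n - Z n))"
      using a by (intro padic_vanishes_add[OF prime_card]) (auto simp: padic_rel_def)
    thus "padic_rel TYPE('p) X Z" using a by (simp add: padic_rel_def)
  qed
qed

typedef (overloaded) 'p padic =
  "{C. \<exists>X. padic_rel TYPE('p::prime_card) X X \<and> C = Collect (padic_rel TYPE('p) X)}"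
  using padic_rel_refl padic_cauchy_const[OF prime_card] by blast

definition Padic :: "(nat \<Rightarrow> rat) \<Rightarrow> 'p::prime_card padic" where
  "Padic X = Abs_padic (Collect (padic_rel TYPE('p) X))"

definition rep_Padic :: "'p::prime_card padic \<Rightarrow> nat \<Rightarrow> rat" where
  "rep_Padic x = (SOME X. X \<in> Rep_padic x)"

definition cr_padic :: "(nat \<Rightarrow> rat) \<Rightarrow> 'p::prime_card padic \<Rightarrow> bool" where
  "cr_padic X x \<longleftrightarrow> padic_rel TYPE('p) X X \<and> Padic X = x"

lemma Quotient_padic:
  "Quotient (padic_rel TYPE('p)) (Padic :: _ \<Rightarrow> 'p::prime_card padic) rep_Padic cr_padic"
proof -
  interpret quot_type "padic_rel TYPE('p)" "Abs_padic :: _ \<Rightarrow> 'p padic" Rep_padic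
    by standard
       (use part_equivp_padic_rel Rep_padic Abs_padic_inverse
         in \<open>auto simp: Rep_padic_inverse Rep_padic_inject\<close>)
  have "abs = Padic" "rep = rep_Padic"
    by (simp_all add: fun_eq_iff abs_def rep_def Padic_def rep_Padic_def)
  hence "Quotient3 (padic_rel TYPE('p)) (Padic :: _ \<Rightarrow> 'p padic) rep_Padic"
    using Quotient by simp
  thus ?thesis
    by (rule Quotient3_to_Quotient) (rule eq_reflection, simp add: cr_padic_def fun_eq_iff)
qed

setup_lifting Quotient_padic

instantiation padic :: (prime_card) field
begin

lift_definition zero_padic :: "'a padic" is "\<lambda>_. 0"
  by (rule padic_rel_refl) (rule padic_cauchy_const[OF prime_card])

lift_definition one_padic :: "'a padic" is "\<lambda>_. 1"
  by (rule padic_rel_refl) (rule padic_cauchy_const[OF prime_card])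

lift_definition plus_padic :: "'a padic \<Rightarrow> 'a padic \<Rightarrow> 'a padic" is "\<lambda>X Y n. X n + Y n"
  using padic_vanishes_add[OF prime_card]
  by (auto simp: padic_rel_def padic_cauchy_add[OF prime_card] add_diff_add)

lift_definition uminus_padic :: "'a padic \<Rightarrow> 'a padic" is "\<lambda>X n. - X n"
  by (auto simp: padic_rel_def padic_cauchy_minus[OF prime_card]
      dest: padic_vanishes_minus[OF prime_card])

lift_definition times_padic :: "'a padic \<Rightarrow> 'a padic \<Rightarrow> 'a padic" is "\<lambda>X Y n. X n * Y n"
proof -
  fix X X' Y Y' assume a: "padic_rel TYPE('a) X X'" "padic_rel TYPE('a) Y Y'"
  have "padic_vanishes CARD('a) (\<lambda>n. X n * (Y n - Y' n) + Y' n * (X n - X' n))"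
    using a by (intro padic_vanishes_add[OF prime_card] padic_vanishes_mult[OF prime_card])
      (auto simp: padic_rel_def)
  thus "padic_rel TYPE('a) (\<lambda>n. X n * Y n) (\<lambda>n. X' n * Y' n)"
    using a by (simp add: padic_rel_def padic_cauchy_mult[OF prime_card] algebra_simps)
qed

lift_definition inverse_padic :: "'a padic \<Rightarrow> 'a padic"
  is "\<lambda>X. if padic_vanishes CARD('a) X then (\<lambda>_. 0) else (\<lambda>n. inverse (X n))"
  using padic_vanishes_cong[OF prime_card]
  by (auto simp: padic_rel_def padic_cauchy_const[OF prime_card] padic_vanishes_0[OF prime_card]
      padic_cauchy_inverse[OF prime_card] padic_vanishes_inverse_diff[OF prime_card])

definition minus_padic :: "'a padic \<Rightarrow> 'a padic \<Rightarrow> 'a padic"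
  where "x - y = x + - y" for x y :: "'a padic"

definition divide_padic :: "'a padic \<Rightarrow> 'a padic \<Rightarrow> 'a padic"
  where "x div y = x * inverse y" for x y :: "'a padic"

instance
proof
  fix a b c :: "'a padic"
  show "a + b = b + a"
    by transfer (simp add: add.commute padic_rel_refl padic_rel_def padic_cauchy_add[OF prime_card]
        padic_vanishes_0[OF prime_card])
  show "(a + b) + c = a + (b + c)"
    by transfer (simp add: add.assoc padic_rel_def padic_cauchy_add[OF prime_card]
        padic_vanishes_0[OF prime_card])
  show "0 + a = a"
    by transfer (simp add: padic_rel_def padic_vanishes_0[OF prime_card])
  show "- a + a = 0"
    by transfer (simp add: padic_rel_def padic_vanishes_0[OF prime_card]
        padic_cauchy_const[OF prime_card])
  show "a - b = a + - b"
    by (rule minus_padic_def)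
  show "(a * b) * c = a * (b * c)"
    by transfer (simp add: mult.assoc padic_rel_def padic_cauchy_mult[OF prime_card]
        padic_vanishes_0[OF prime_card])
  show "a * b = b * a"
    by transfer (simp add: mult.commute padic_rel_def padic_cauchy_mult[OF prime_card]
        padic_vanishes_0[OF prime_card])
  show "1 * a = a"
    by transfer (simp add: padic_rel_def padic_vanishes_0[OF prime_card])
  show "(a + b) * c = a * c + b * c"
    by transfer (simp add: distrib_right padic_rel_def padic_cauchy_mult[OF prime_card]
        padic_cauchy_add[OF prime_card] padic_vanishes_0[OF prime_card])
  show "(0::'a padic) \<noteq> 1"
    by transfer (simp add: padic_rel_def padic_vanishes_const_iff[OF prime_card])
  show "inverse (0::'a padic) = 0"
    by transfer (simp add: padic_rel_def padic_vanishes_0[OF prime_card]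
        padic_cauchy_const[OF prime_card])
  show "a div b = a * inverse b"
    by (rule divide_padic_def)
  show "inverse a * a = 1" if "a \<noteq> 0"
    using that
  proof transfer
    fix X assume X: "padic_rel TYPE('a) X X" and nz: "\<not> padic_rel TYPE('a) X (\<lambda>_. 0)"
    have c: "padic_cauchy CARD('a) X" using X by (simp add: padic_rel_def)
    have nv: "\<not> padic_vanishes CARD('a) X"
      using nz c by (simp add: padic_rel_def padic_cauchy_const[OF prime_card])
    obtain d N where d: "d > 0" "\<And>n. n \<ge> N \<Longrightarrow> padic_abs CARD('a) (X n) \<ge> d"
      using padic_cauchy_not_vanishes[OF prime_card c nv] by blast
    have "\<forall>\<^sub>F n in sequentially. padic_abs CARD('a) (inverse (X n) * X n - 1) = 0"
      using eventually_ge_at_top[of N]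
    proof eventually_elim
      case (elim n)
      have "X n \<noteq> 0" using d(1) d(2)[OF elim] padic_abs_0[OF prime_card[where 'a='a]] by auto
      thus ?case by (simp add: padic_abs_0[OF prime_card])
    qed
    hence "padic_vanishes CARD('a) (\<lambda>n. inverse (X n) * X n - 1)"
      unfolding padic_vanishes_def by (rule tendsto_eventually)
    thus "padic_rel TYPE('a)
        (\<lambda>n. (if padic_vanishes CARD('a) X then \<lambda>_. 0 else (\<lambda>n. inverse (X n))) n * X n) (\<lambda>_. 1)"
      using nv c by (simp add: padic_rel_def padic_cauchy_const[OF prime_card]
          padic_cauchy_mult[OF prime_card] padic_cauchy_inverse[OF prime_card])
  qed
qed

end


subsection \<open>The absolute value and the metric\<close>

lift_definition padic_norm :: "'a::prime_card padic \<Rightarrow> real" is "\<lambda>X. lim (\<lambda>n. padic_abs CARD('a) (X n))"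
proof -
  fix X Y assume a: "padic_rel TYPE('a) X Y"
  obtain l where l: "(\<lambda>n. padic_abs CARD('a) (Y n)) \<longlonglongrightarrow> l"
    using a padic_cauchy_convergent[OF prime_card] by (auto simp: padic_rel_def convergent_def)
  have lim: "(\<lambda>n. padic_abs CARD('a) (X n - Y n)) \<longlonglongrightarrow> 0"
    using a by (simp add: padic_rel_def padic_vanishes_def)
  have "(\<lambda>n. padic_abs CARD('a) (X n) - padic_abs CARD('a) (Y n)) \<longlonglongrightarrow> 0"
    by (rule Lim_null_comparison[OF always_eventually lim])
       (simp add: padic_abs_reverse_triangle[OF prime_card])
  from tendsto_add[OF this l] have "(\<lambda>n. padic_abs CARD('a) (X n)) \<longlonglongrightarrow> l" by simp
  thus "lim (\<lambda>n. padic_abs CARD('a) (X n)) = lim (\<lambda>n. padic_abs CARD('a) (Y n))"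
    using limI[OF l] by (simp add: limI)
qed

lemma padic_rel_tendsto_norm:
  assumes "padic_rel TYPE('p::prime_card) X X"
  shows "(\<lambda>n. padic_abs CARD('p) (X n)) \<longlonglongrightarrow> lim (\<lambda>n. padic_abs CARD('p) (X n))"
  using assms padic_cauchy_convergent[OF prime_card]
  by (auto simp: padic_rel_def convergent_LIMSEQ_iff)

lemma padic_norm_nonneg [simp]: "0 \<le> padic_norm (x :: 'p::prime_card padic)"
proof transfer
  fix X assume "padic_rel TYPE('p) X X"
  from padic_rel_tendsto_norm[OF this]
  show "0 \<le> lim (\<lambda>n. padic_abs CARD('p) (X n))"
    by (rule LIMSEQ_le_const) (auto simp: padic_abs_nonneg[OF prime_card])
qed

lemma padic_norm_eq_0_iff [simp]: "padic_norm x = 0 \<longleftrightarrow> x = 0" for x :: "'p::prime_card padic"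
proof transfer
  fix X assume X: "padic_rel TYPE('p) X X"
  have "lim (\<lambda>n. padic_abs CARD('p) (X n)) = 0 \<longleftrightarrow> padic_vanishes CARD('p) X"
    unfolding padic_vanishes_def
    using padic_rel_tendsto_norm[OF X] limI[of "\<lambda>n. padic_abs CARD('p) (X n)" 0] by metis
  also have "\<dots> \<longleftrightarrow> padic_rel TYPE('p) X (\<lambda>_. 0)"
    using X by (simp add: padic_rel_def padic_cauchy_const[OF prime_card])
  finally show "lim (\<lambda>n. padic_abs CARD('p) (X n)) = 0 \<longleftrightarrow> padic_rel TYPE('p) X (\<lambda>_. 0)" .
qed

lemma padic_norm_0 [simp]: "padic_norm (0 :: 'p::prime_card padic) = 0"
  by simp

lemma padic_norm_mult: "padic_norm (x * y) = padic_norm x * padic_norm y" for x y :: "'p::prime_card padic"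
proof transfer
  fix X Y assume X: "padic_rel TYPE('p) X X" and Y: "padic_rel TYPE('p) Y Y"
  show "lim (\<lambda>n. padic_abs CARD('p) (X n * Y n))
      = lim (\<lambda>n. padic_abs CARD('p) (X n)) * lim (\<lambda>n. padic_abs CARD('p) (Y n))"
    using tendsto_mult[OF padic_rel_tendsto_norm[OF X] padic_rel_tendsto_norm[OF Y]]
    by (intro limI) (simp add: padic_abs_mult[OF prime_card])
qed

lemma padic_norm_minus [simp]: "padic_norm (- x) = padic_norm x" for x :: "'p::prime_card padic"
  by transfer (simp add: padic_abs_minus[OF prime_card])

lemma padic_norm_ultra: "padic_norm (x + y) \<le> max (padic_norm x) (padic_norm y)" for x y :: "'p::prime_card padic"
proof transfer
  fix X Y assume X: "padic_rel TYPE('p) X X" and Y: "padic_rel TYPE('p) Y Y"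
  have XY: "padic_rel TYPE('p) (\<lambda>n. X n + Y n) (\<lambda>n. X n + Y n)"
    using X Y by (intro padic_rel_refl padic_cauchy_add[OF prime_card]) (auto simp: padic_rel_def)
  show "lim (\<lambda>n. padic_abs CARD('p) (X n + Y n))
      \<le> max (lim (\<lambda>n. padic_abs CARD('p) (X n))) (lim (\<lambda>n. padic_abs CARD('p) (Y n)))"
    using padic_rel_tendsto_norm[OF XY]
      tendsto_max[OF padic_rel_tendsto_norm[OF X] padic_rel_tendsto_norm[OF Y]]
    by (rule LIMSEQ_le) (auto simp: padic_abs_ultra[OF prime_card])
qed

instantiation padic :: (prime_card) metric_space
begin

definition dist_padic :: "'a padic \<Rightarrow> 'a padic \<Rightarrow> real" where
  "dist_padic x y = padic_norm (x - y)"

definition uniformity_padic :: "('a padic \<times> 'a padic) filter" where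
  "uniformity_padic = (INF e\<in>{0<..}. principal {(x, y). dist x y < e})"

definition open_padic :: "'a padic set \<Rightarrow> bool" where
  "open_padic U \<longleftrightarrow> (\<forall>x\<in>U. \<forall>\<^sub>F (x', y) in uniformity. x' = x \<longrightarrow> y \<in> U)"

instance
proof
  fix x y z :: "'a padic"
  show "dist x y = 0 \<longleftrightarrow> x = y" by (simp add: dist_padic_def)
  have "padic_norm ((x - z) + - (y - z)) \<le> max (padic_norm (x - z)) (padic_norm (- (y - z)))"
    by (rule padic_norm_ultra)
  also have "\<dots> \<le> padic_norm (x - z) + padic_norm (y - z)"
    using padic_norm_nonneg[of "x - z"] padic_norm_nonneg[of "y - z"]
    unfolding padic_norm_minus by linarith
  finally show "dist x y \<le> dist x z + dist y z" by (simp add: dist_padic_def)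
qed (rule uniformity_padic_def open_padic_def)+

end

lift_definition padic_const :: "rat \<Rightarrow> 'a::prime_card padic" is "\<lambda>q _. q"
  by (rule padic_rel_refl) (rule padic_cauchy_const[OF prime_card])

lemma padic_const_of_nat: "padic_const (of_nat n) = (of_nat n :: 'p::prime_card padic)"
proof (induction n)
  case 0
  have "padic_const 0 = (0 :: 'p padic)"
    by transfer (rule padic_rel_refl, rule padic_cauchy_const[OF prime_card])
  thus ?case by simp
next
  case (Suc n)
  have "padic_const (1 + of_nat n) = (1 + padic_const (of_nat n) :: 'p padic)"
    by transfer (rule padic_rel_refl, rule padic_cauchy_const[OF prime_card])
  thus ?case using Suc by simp
qed

lemma padic_const_eq_0_iff: "padic_const q = (0 :: 'p::prime_card padic) \<longleftrightarrow> q = 0"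
  by transfer (simp add: padic_rel_def padic_cauchy_const[OF prime_card]
      padic_vanishes_const_iff[OF prime_card])

lemma padic_norm_const: "padic_norm (padic_const q :: 'p::prime_card padic) = padic_abs CARD('p) q"
  by transfer simp

instance padic :: (prime_card) field_char_0
proof
  have *: "of_nat n = (0 :: 'a padic) \<longleftrightarrow> n = 0" for n
    by (simp add: padic_const_of_nat[symmetric] padic_const_eq_0_iff)
  show "inj (of_nat :: nat \<Rightarrow> 'a padic)"
  proof (rule injI)
    fix m n assume "of_nat m = (of_nat n :: 'a padic)"
    thus "m = n"
    proof (induction m n rule: linorder_wlog)
      case (le a b)
      hence "of_nat (b - a) = (0 :: 'a padic)" by (simp add: of_nat_diff)
      with *[of "b - a"] have "b - a = 0" by simp
      thus ?case using le by simp
    qed auto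
  qed
qed

lemma padic_norm_of_rat: "padic_norm (of_rat q :: 'p::prime_card padic) = padic_abs CARD('p) q"
proof -
  have nat: "padic_norm (of_nat n :: 'p padic) = padic_abs CARD('p) (of_nat n)" for n
    by (simp add: padic_const_of_nat[symmetric] padic_norm_const)
  have int: "padic_norm (of_int k :: 'p padic) = padic_abs CARD('p) (of_int k)" for k
    by (cases k rule: int_cases2) (simp_all add: nat padic_abs_minus[OF prime_card])
  obtain a b :: int where ab: "b \<noteq> 0" "q = of_int a / of_int b"
    by (rule rat_as_fraction[OF prime_card[where 'a='p]])
  have "padic_norm (of_rat q * of_int b :: 'p padic) = padic_abs CARD('p) (q * of_int b)"
    using ab by (simp add: of_rat_divide int)
  hence "padic_norm (of_rat q :: 'p padic) * padic_abs CARD('p) (of_int b)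
       = padic_abs CARD('p) q * padic_abs CARD('p) (of_int b)"
    by (simp add: padic_norm_mult padic_abs_mult[OF prime_card] int)
  thus ?thesis using ab by (simp add: padic_abs_eq_0_iff[OF prime_card])
qed


section \<open>The dynamical system\<close>

text \<open>At the pole \<open>x = - b / a\<close>, which lies on none of the spheres considered, division by zero
  yields the value \<open>0\<close>.\<close>

definition ratmap :: "'p::prime_card padic \<Rightarrow> 'p padic \<Rightarrow> 'p padic \<Rightarrow> 'p padic" where
  "ratmap a b x = (x ^ 3 + a * x ^ 2 + b * x) / (a * x + b)"

text \<open>\<open>\<alpha>\<close>, \<open>\<beta>\<close> and \<open>\<delta>\<close> stand for the absolute values of \<open>x\<^sub>1\<close>, \<open>x\<^sub>2\<close> and \<open>a\<close>; the last case
  does not occur, see \<open>radii_cases\<close> below.\<close>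

definition radii :: "real \<Rightarrow> real \<Rightarrow> real \<Rightarrow> real set" where
  "radii \<alpha> \<beta> \<delta> =
     (if \<delta> \<le> \<alpha> \<and> \<alpha> = \<beta> then {0<..<\<alpha>}
      else if \<alpha> < \<beta> \<and> \<beta> = \<delta> then {0<..<\<beta>} - {\<alpha>}
      else {})"

lemma radii_cases:
  fixes a b s :: "'p::prime_card padic"
  assumes "x1 = (- a + s) / 2 \<and> x2 = (- a - s) / 2 \<or> x1 = (- a - s) / 2 \<and> x2 = (- a + s) / 2"
    and "padic_norm x1 \<le> padic_norm x2"
  shows "padic_norm a \<le> padic_norm x1 \<and> padic_norm x1 = padic_norm x2 \<or> padic_norm x1 < padic_norm x2 \<and> padic_norm x2 = padic_norm a"
proof -
  have "x1 * 2 + x2 * 2 = - a - a" using assms(1) by auto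
  moreover have "(a + (x1 + x2)) * 2 = (a + a) + (x1 * 2 + x2 * 2)"
    by (simp add: distrib_right mult_2_right add_ac)
  ultimately have "(a + (x1 + x2)) * 2 = 0" by simp
  hence "a + (x1 + x2) = 0" by (simp only: mult_eq_0_iff zero_neq_numeral[symmetric] simp_thms)
  hence a: "a = - (x1 + x2)" by (simp only: eq_neg_iff_add_eq_0)
  have "padic_norm a \<le> max (padic_norm x1) (padic_norm x2)"
    unfolding a padic_norm_minus by (rule padic_norm_ultra)
  moreover have "x2 = - a + - x1" by (simp add: a)
  hence "padic_norm x2 \<le> max (padic_norm a) (padic_norm x1)"
    using padic_norm_ultra[of "- a" "- x1"] by (simp only: padic_norm_minus)
  ultimately show ?thesis using assms(2) by linarith
qed

definition normalized_haar_sphere :: "real \<Rightarrow> 'p::prime_card padic measure \<Rightarrow> bool" where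
  "normalized_haar_sphere r \<mu> \<longleftrightarrow>
     prob_space \<mu> \<and> sets \<mu> = sets (restrict_space borel (sphere 0 r)) \<and>
     (\<forall>c n. cball c (real CARD('p) powi n) \<subseteq> sphere 0 r \<longrightarrow>
        measure \<mu> (cball c (real CARD('p) powi n))
          = real CARD('p) powi n / (r * (1 - 1 / real CARD('p))))"

text \<open>Measure preservation is not part of this predicate, so its negation really asserts the
  existence of an invariant set of intermediate measure.\<close>

definition ergodic :: "'a measure \<Rightarrow> ('a \<Rightarrow> 'a) \<Rightarrow> bool" where
  "ergodic M f \<longleftrightarrow>
     (\<forall>V\<in>sets M. f -` V \<inter> space M = V \<longrightarrow> measure M V = 0 \<or> measure M V = 1)"

end

theory Submission
  imports Defs
begin

text \<open>
  Since \<open>f x - x = x\<^sup>3 / (a x + b)\<close> and \<open>\<bar>a x + b\<bar>\<close> is determined by \<open>r = \<bar>x\<bar>\<close> for \<open>r \<in> A\<close>, the map moves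
  every point of the sphere by at most \<open>r / p\<^sup>k\<close>, with \<open>k = 1\<close> always, and with \<open>k = 2\<close> unless
  \<open>\<alpha> < r = \<beta> / p\<close>. By the ultrametric inequality every ball of radius \<open>r / p\<^sup>k\<close> in the sphere is then
  invariant. Its measure \<open>p\<^sup>-\<^sup>k / (1 - 1/p)\<close> lies strictly between 0 and 1, for \<open>k = 1\<close> if \<open>p \<ge> 3\<close>
  and for \<open>k = 2\<close> if \<open>p = 2\<close>.
\<close>

text \<open>The isosceles principle: writing x as (x + y) + (- y), the ultrametric bound would make
  |x| at most |y| if |x + y| were smaller than |x|.\<close>

lemma padic_norm_add_eq:
  fixes x y :: "'p::prime_card padic"
  assumes "padic_norm y < padic_norm x"
  shows "padic_norm (x + y) = padic_norm x"
proof -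
  have "padic_norm ((x + y) + - y) \<le> max (padic_norm (x + y)) (padic_norm (- y))"
    by (rule padic_norm_ultra)
  hence "padic_norm x \<le> max (padic_norm (x + y)) (padic_norm y)" by simp
  thus ?thesis using padic_norm_ultra[of x y] assms by linarith
qed

lemma padic_norm_divide:
  fixes x y :: "'p::prime_card padic"
  shows "padic_norm (x / y) = padic_norm x / padic_norm y"
proof (cases "y = 0")
  case False
  have "padic_norm (x / y * y) = padic_norm (x / y) * padic_norm y" by (rule padic_norm_mult)
  thus ?thesis using False by (simp add: field_simps)
qed simp

lemma padic_norm_power:
  fixes x :: "'p::prime_card padic"
  shows "padic_norm (x ^ n) = padic_norm x ^ n"
proof (induction n)
  case 0
  have "padic_norm (1 :: 'p padic) = 1"
    using padic_norm_of_rat[of 1, where 'p='p] by (simp add: padic_abs_1[OF prime_card])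
  thus ?case by simp
qed (simp add: padic_norm_mult)

lemma padic_const_dense:
  fixes x :: "'p::prime_card padic"
  assumes "e > 0"
  obtains q where "padic_norm (x - padic_const q) < e"
proof -
  \<comment> \<open>Subtraction is not a lifted operation, so the difference is phrased with
    \<open>+\<close> and unary minus, for which transfer has rules.\<close>
  have "\<exists>q. padic_norm (x + - padic_const q) < e"
    using assms
  proof (transfer fixing: e)
    fix X :: "nat \<Rightarrow> rat"
    assume X: "padic_rel TYPE('p) X X" and e: "e > 0"
    \<comment> \<open>The limit preserves only a non-strict bound; \<open>e / 2\<close> leaves room
      for the strict one. The witness is the term \<open>X N\<close> of the representing
      sequence.\<close>
    obtain N where N: "\<forall>m\<ge>N. \<forall>n\<ge>N. padic_abs CARD('p) (X m - X n) < e / 2"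
      using X e unfolding padic_rel_def padic_cauchy_def by (meson half_gt_zero)
    have "padic_rel TYPE('p) (\<lambda>n. X n + - X N) (\<lambda>n. X n + - X N)"
      using X by (intro padic_rel_refl padic_cauchy_add[OF prime_card] padic_cauchy_const[OF prime_card])
        (auto simp: padic_rel_def)
    from padic_rel_tendsto_norm[OF this]
    have "lim (\<lambda>n. padic_abs CARD('p) (X n + - X N)) \<le> e / 2"
      by (rule LIMSEQ_le_const2) (use N in \<open>auto intro!: exI[of _ N] less_imp_le\<close>)
    thus "\<exists>q. lim (\<lambda>n. padic_abs CARD('p) (X n + - q)) < e"
      using e by (intro exI[of _ "X N"]) simp
  qed
  thus ?thesis using that by auto
qed

text \<open>Completion adds no new absolute values: a rational closer to x than |x| has the same
  absolute value as x, by the isosceles principle.\<close>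

lemma padic_norm_powi:
  fixes x :: "'p::prime_card padic"
  assumes "x \<noteq> 0"
  obtains k where "padic_norm x = real CARD('p) powi k"
proof -
  have "padic_norm x > 0"
    using assms padic_norm_nonneg[of x] padic_norm_eq_0_iff[of x] by linarith
  then obtain q where q: "padic_norm (x - padic_const q) < padic_norm x"
    by (rule padic_const_dense)
  have "padic_norm (x + - (x - padic_const q)) = padic_norm x"
    using q by (intro padic_norm_add_eq) (simp only: padic_norm_minus)
  hence eq: "padic_norm x = padic_abs CARD('p) q" by (simp add: padic_norm_const)
  hence "q \<noteq> 0" using assms padic_abs_0[OF prime_card[where 'a='p]] by auto
  thus ?thesis using that eq by (auto simp: padic_abs_def)
qed

text \<open>Nonzero absolute values are integer powers of p, so a strict inequality between them
  leaves a gap of a full factor p.\<close>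

lemma padic_norm_discrete:
  fixes x y :: "'p::prime_card padic"
  assumes "padic_norm x * real CARD('p) ^ k < padic_norm y"
  shows "padic_norm x * real CARD('p) ^ Suc k \<le> padic_norm y"
proof (cases "x = 0")
  case False
  have p1: "real CARD('p) > 1" using prime_gt_1_nat[OF prime_card[where 'a='p]] by simp
  obtain m where m: "padic_norm x = real CARD('p) powi m" using padic_norm_powi[OF False] .
  have "padic_norm y \<noteq> 0" using assms
    by (smt (verit) padic_norm_nonneg mult_nonneg_nonneg zero_le_power of_nat_0_le_iff)
  then obtain n where n: "padic_norm y = real CARD('p) powi n" using padic_norm_powi[of y] by auto
  have mk: "padic_norm x * real CARD('p) ^ j = real CARD('p) powi (m + int j)" for j
    using p1 by (simp add: m power_int_add)
  have "m + int k < n"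
    using assms p1 unfolding mk n by (meson power_int_increasing not_less less_imp_le)
  hence "m + int (Suc k) \<le> n" by simp
  thus ?thesis unfolding mk n using p1 by (intro power_int_increasing) auto
qed simp

text \<open>The point \<open>c\<close> serves as centre of the invariant ball and shows that r is a
  power of p. Assumption \<open>k\<close> says that the measure of this ball is below 1.\<close>

lemma not_ergodic_if_small_displacement:
  fixes f :: "'p::prime_card padic \<Rightarrow> 'p padic" and c :: "'p padic"
  assumes haar: "normalized_haar_sphere r \<mu>" and c: "padic_norm c = r" "r > 0"
    and k: "1 / real CARD('p) ^ k < 1 - 1 / real CARD('p)"
    and f: "\<And>x. padic_norm x = r \<Longrightarrow> padic_norm (f x - x) \<le> r / real CARD('p) ^ k"
  shows "\<not> ergodic \<mu> f"
proof
  assume erg: "ergodic \<mu> f"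
  define p where "p = real CARD('p)"
  have p1: "p > 1" using prime_gt_1_nat[OF prime_card[where 'a='p]] by (simp add: p_def)
  \<comment> \<open>The measure formula covers only radii that are integer powers of p.\<close>
  obtain m where m: "r = p powi m"
    using padic_norm_powi[of c] c unfolding p_def by fastforce
  define \<rho> where "\<rho> = r / p ^ k"
  have \<rho>: "\<rho> = p powi (m - int k)"
    using p1 by (simp add: \<rho>_def m power_int_diff)
  have \<rho>0: "0 < \<rho>" using p1 by (simp add: \<rho>)
  \<comment> \<open>Used twice: it puts the ball inside the sphere, and at the end it excludes
    measure 1.\<close>
  have \<rho>r: "\<rho> < r * (1 - 1 / p)"
    using mult_strict_left_mono[OF k c(2)] by (simp add: \<rho>_def p_def)
  also have "\<dots> < r" using p1 c by (simp add: field_simps)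
  finally have "\<rho> < r" .
  define V where "V = cball c \<rho>"
  have inV: "x \<in> V \<longleftrightarrow> padic_norm (x - c) \<le> \<rho>" for x
    using padic_norm_minus[of "x - c"] by (simp add: V_def dist_padic_def)
  have sph: "x \<in> sphere 0 r \<longleftrightarrow> padic_norm x = r" for x :: "'p padic"
    by (simp add: dist_padic_def)
  have sub: "V \<subseteq> sphere 0 r"
  proof
    fix x assume "x \<in> V"
    hence "padic_norm (c + (x - c)) = padic_norm c"
      using \<open>\<rho> < r\<close> c by (intro padic_norm_add_eq) (simp add: inV)
    thus "x \<in> sphere 0 r" using c unfolding sph by simp
  qed
  have sets: "sets \<mu> = sets (restrict_space borel (sphere 0 r))"
    and mV: "measure \<mu> V = \<rho> / (r * (1 - 1 / p))"
    using haar sub unfolding normalized_haar_sphere_def V_def \<rho> p_def by blast+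
  have space: "space \<mu> = sphere 0 r"
    using sets_eq_imp_space_eq[OF sets] by (simp add: space_restrict_space)
  have "V \<in> sets \<mu>"
    unfolding sets sets_restrict_space using sub by (auto simp: V_def intro!: image_eqI[of _ _ V])
  \<comment> \<open>x - c and f x - c differ by the displacement, of size at most \<rho>. Both
    directions are required, as invariance is an equality with the preimage.\<close>
  moreover have "f x \<in> V \<longleftrightarrow> x \<in> V" if "x \<in> sphere 0 r" for x
  proof -
    have d: "padic_norm (f x - x) \<le> \<rho>" using f that unfolding sph \<rho>_def p_def by blast
    have "padic_norm ((x - c) + (f x - x)) \<le> max (padic_norm (x - c)) (padic_norm (f x - x))"
      "padic_norm ((f x - c) + - (f x - x)) \<le> max (padic_norm (f x - c)) (padic_norm (- (f x - x)))"
      by (rule padic_norm_ultra)+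
    thus ?thesis using d unfolding inV padic_norm_minus by auto
  qed
  hence "f -` V \<inter> space \<mu> = V" using sub unfolding space by blast
  ultimately have "measure \<mu> V = 0 \<or> measure \<mu> V = 1" using erg by (auto simp: ergodic_def)
  thus False using \<rho>r \<rho>0 c p1 unfolding mV by (auto simp: field_simps)
qed

lemma ratmap_minus_self:
  assumes "a * x + b \<noteq> 0"
  shows "ratmap a b x - x = x ^ 3 / (a * x + b)"
  using assms by (simp add: ratmap_def field_simps power2_eq_square power3_eq_cube)

text \<open>On the admissible spheres one term of a x + b dominates: b if r < \<alpha>, giving
  displacement r^3 / (\<alpha> \<beta>), and a x if r > \<alpha>, giving r^2 / \<beta>. Discreteness
  of the absolute value turns these into powers of p.\<close>

lemma ratmap_displacement_le:
  fixes x x1 x2 :: "'p::prime_card padic"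
  defines "p \<equiv> real CARD('p)"
  assumes a: "a = - (x1 + x2)" and b: "b = x1 * x2" and nz: "b \<noteq> 0"
    and le: "padic_norm x1 \<le> padic_norm x2"
    and r: "padic_norm x \<in> radii (padic_norm x1) (padic_norm x2) (padic_norm a)"
  shows "padic_norm (ratmap a b x - x) \<le> padic_norm x / p"
    and "padic_norm x1 = padic_norm x2 \<or> padic_norm x \<noteq> padic_norm x2 / p \<Longrightarrow>
      padic_norm (ratmap a b x - x) \<le> padic_norm x / p ^ 2"
proof -
  define r \<alpha> \<beta> where "r = padic_norm x" and "\<alpha> = padic_norm x1" and "\<beta> = padic_norm x2"
  note defs = r_def[symmetric] \<alpha>_def[symmetric] \<beta>_def[symmetric]
  have p1: "p > 1" using prime_gt_1_nat[OF prime_card[where 'a='p]] by (simp add: p_def)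
  have "\<alpha> \<noteq> 0" using nz b by (simp add: \<alpha>_def)
  hence \<alpha>0: "\<alpha> > 0" using padic_norm_nonneg[of x1] unfolding \<alpha>_def by linarith
  have \<alpha>\<beta>: "\<alpha> \<le> \<beta>" using le by (simp add: defs)
  have r0: "0 < r" and r\<beta>: "r < \<beta>"
    using r by (auto simp: radii_def defs split: if_splits)
  have r\<beta>p: "r * p \<le> \<beta>"
    using padic_norm_discrete[of x 0 x2] r\<beta> by (simp add: r_def \<beta>_def p_def)
  have nb: "padic_norm b = \<alpha> * \<beta>" by (simp add: b padic_norm_mult defs)
  have nax: "padic_norm (a * x) = padic_norm a * r" by (simp add: padic_norm_mult defs)
  \<comment> \<open>Positivity of \<open>d\<close> keeps x off the pole.\<close>
  have disp: "padic_norm (ratmap a b x - x) = r ^ 3 / d" if "padic_norm (a * x + b) = d" "d > 0" for d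
    using that by (subst ratmap_minus_self) (auto simp: padic_norm_divide padic_norm_power defs)
  consider "r < \<alpha>" | "\<alpha> < r" "\<alpha> < \<beta>" "padic_norm a = \<beta>"
    using r unfolding defs radii_def by (fastforce split: if_splits)
  hence "padic_norm (ratmap a b x - x) \<le> r / p \<and>
    (\<alpha> = \<beta> \<or> r \<noteq> \<beta> / p \<longrightarrow> padic_norm (ratmap a b x - x) \<le> r / p ^ 2)"
  proof cases
    case 1
    have "padic_norm a \<le> \<beta>"
      using padic_norm_ultra[of x1 x2] \<alpha>\<beta> unfolding a padic_norm_minus defs by simp
    hence "padic_norm a * r \<le> \<beta> * r" using r0 by simp
    also have "\<dots> < \<alpha> * \<beta>" using 1 \<alpha>0 \<alpha>\<beta> by simp
    finally have "padic_norm (b + a * x) = padic_norm b"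
      by (intro padic_norm_add_eq) (simp add: nb nax)
    hence eq: "padic_norm (ratmap a b x - x) = r ^ 3 / (\<alpha> * \<beta>)"
      using \<alpha>0 \<alpha>\<beta> by (intro disp) (auto simp: nb add.commute)
    \<comment> \<open>Here r is below both \<alpha> and \<beta>, and each contributes a factor p, so
      the stronger bound holds without a side condition.\<close>
    have "r * p \<le> \<alpha>"
      using padic_norm_discrete[of x 0 x1] 1 by (simp add: r_def \<alpha>_def p_def)
    hence "(r * p) * (r * p) \<le> \<alpha> * \<beta>" using r\<beta>p r0 p1 \<alpha>0 by (intro mult_mono) auto
    hence "r * ((r * p) * (r * p)) \<le> r * (\<alpha> * \<beta>)" using r0 by simp
    hence "padic_norm (ratmap a b x - x) \<le> r / p ^ 2"
      using \<alpha>0 \<alpha>\<beta> p1 unfolding eq by (simp add: field_simps power2_eq_square power3_eq_cube)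
    moreover have "r / p ^ 2 \<le> r / p"
      using p1 r0 by (intro divide_left_mono) (auto simp: power2_eq_square)
    ultimately show ?thesis by linarith
  next
    case 2
    have "padic_norm (a * x + b) = padic_norm (a * x)"
      using 2 \<alpha>0 by (intro padic_norm_add_eq) (simp add: nb nax mult.commute)
    hence eq: "padic_norm (ratmap a b x - x) = r ^ 3 / (\<beta> * r)"
      using 2 \<alpha>0 by (intro disp) (auto simp: nax)
    have eq: "padic_norm (ratmap a b x - x) = r * (r / \<beta>)"
      unfolding eq using r0 by (simp add: power3_eq_cube)
    have "r / \<beta> \<le> 1 / p" using r\<beta>p p1 r0 r\<beta> by (simp add: field_simps)
    hence 1: "padic_norm (ratmap a b x - x) \<le> r / p"
      unfolding eq using r0 mult_left_mono[of "r / \<beta>" "1 / p" r] by simp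
    \<comment> \<open>Only the single quotient r / \<beta> is available now. Excluding equality in r
      p \<le> \<beta> lets discreteness supply a second factor p.\<close>
    have "padic_norm (ratmap a b x - x) \<le> r / p ^ 2" if "r \<noteq> \<beta> / p"
    proof -
      have "r * p < \<beta>" using that r\<beta>p p1 by (auto simp: field_simps)
      hence "r * p ^ 2 \<le> \<beta>"
        using padic_norm_discrete[of x 1 x2] by (simp add: r_def \<beta>_def p_def numeral_2_eq_2)
      hence "r / \<beta> \<le> 1 / p ^ 2" using p1 r0 r\<beta> by (simp add: field_simps)
      thus ?thesis
        unfolding eq using r0 mult_left_mono[of "r / \<beta>" "1 / p ^ 2" r] by simp
    qed
    thus ?thesis using 1 2 by auto
  qed
  thus "padic_norm (ratmap a b x - x) \<le> padic_norm x / p"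
    and "padic_norm x1 = padic_norm x2 \<or> padic_norm x \<noteq> padic_norm x2 / p \<Longrightarrow>
      padic_norm (ratmap a b x - x) \<le> padic_norm x / p ^ 2"
    by (auto simp: defs)
qed

theorem theorem6:
  fixes a b s x1 x2 :: "'p::prime_card padic"
    and \<alpha> \<beta> \<delta> :: real
  assumes "a * b \<noteq> 0"
    and "s ^ 2 = a ^ 2 - 4 * b"
    and "x1 = (- a + s) / 2 \<and> x2 = (- a - s) / 2 \<or> x1 = (- a - s) / 2 \<and> x2 = (- a + s) / 2"
    and "\<alpha> = padic_norm x1" and "\<beta> = padic_norm x2" and "\<alpha> \<le> \<beta>"
    and "\<delta> = padic_norm a"
  shows "(CARD('p) \<ge> 3 \<longrightarrow>
            (\<forall>r \<in> radii \<alpha> \<beta> \<delta> \<inter> range (padic_norm :: 'p padic \<Rightarrow> real).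
             \<forall>\<mu>. normalized_haar_sphere r \<mu> \<longrightarrow> \<not> ergodic \<mu> (ratmap a b))) \<and>
         (CARD('p) = 2 \<longrightarrow>
            (\<alpha> = \<beta> \<longrightarrow>
              (\<forall>r \<in> radii \<alpha> \<beta> \<delta> \<inter> range (padic_norm :: 'p padic \<Rightarrow> real).
               \<forall>\<mu>. normalized_haar_sphere r \<mu> \<longrightarrow> \<not> ergodic \<mu> (ratmap a b))) \<and>
            (\<alpha> < \<beta> \<longrightarrow>
              (\<forall>r \<in> (radii \<alpha> \<beta> \<delta> - {\<beta> / 2}) \<inter> range (padic_norm :: 'p padic \<Rightarrow> real).
               \<forall>\<mu>. normalized_haar_sphere r \<mu> \<longrightarrow> \<not> ergodic \<mu> (ratmap a b))))"
proof -
  \<comment> \<open>Vieta's formulas for x^2 + a x + b, symmetric in the two labellings of the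
    roots.\<close>
  have "(x1 + x2) * 2 = (- a) * 2" using assms(3) by (auto simp: distrib_right)
  hence "x1 + x2 = - a" by (simp only: mult_cancel_right) simp
  hence a: "a = - (x1 + x2)" by simp
  have "x1 * x2 = (- a + s) * (- a - s) / (2 * 2)"
    using assms(3) by (elim disjE conjE) (simp_all only: times_divide_times_eq mult.commute)
  also have "(- a + s) * (- a - s) = a ^ 2 - s ^ 2"
    by (simp add: algebra_simps power2_eq_square)
  finally have b: "b = x1 * x2" by (simp add: assms(2))
  have nz: "b \<noteq> 0" using assms(1) by auto
  have le: "padic_norm x1 \<le> padic_norm x2" using assms by simp
  note disp = ratmap_displacement_le[OF a b nz le]
  have *: "\<not> ergodic \<mu> (ratmap a b)"
    if r: "r \<in> radii \<alpha> \<beta> \<delta> \<inter> range (padic_norm :: 'p padic \<Rightarrow> real)"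
      and \<mu>: "normalized_haar_sphere r \<mu>"
      and cases: "CARD('p) \<ge> 3 \<or> CARD('p) = 2 \<and> (\<alpha> = \<beta> \<or> r \<noteq> \<beta> / 2)" for r \<mu>
  proof -
    obtain c :: "'p padic" where c: "padic_norm c = r" using r by auto
    have r0: "r > 0" using r by (auto simp: radii_def split: if_splits)
    from cases show ?thesis
    proof
      \<comment> \<open>Exponent 1 suffices, as 1/p < 1 - 1/p exactly when p > 2.\<close>
      assume "CARD('p) \<ge> 3"
      thus ?thesis using disp(1) r assms(4,5,7)
        by (intro not_ergodic_if_small_displacement[OF \<mu> c r0, of 1]) (auto simp: field_simps)
    next
      \<comment> \<open>For p = 2 a ball of radius r/2 is the whole sphere, so exponent 2 is taken:
        1/4 < 1/2. The excluded radius \<beta>/2 is \<beta>/p.\<close>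
      assume "CARD('p) = 2 \<and> (\<alpha> = \<beta> \<or> r \<noteq> \<beta> / 2)"
      thus ?thesis using disp(2) r assms(4,5,7)
        by (intro not_ergodic_if_small_displacement[OF \<mu> c r0, of 2]) (auto simp: field_simps)
    qed
  qed
  show ?thesis
    by (intro conjI impI ballI allI; rule *) auto
qed

end
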